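(* Let $\mathcal{A}=(A;\theta)$ be a monounary algebra. Then $\mathcal{A}$ is ultrahomogeneous if and only if, whenever $x,y\in A$ are such that $\langle x\rangle\cong\langle y\rangle$, then $|\theta^{-1}(x)|=|\theta^{-1}(y)|$ and the connected components of $\mathcal{A}$ containing $x$ and $y$ are isomorphic.
   Context: A monounary algebra is a pair $\mathcal{A}=(A;\theta)$ where $A$ is a nonempty set (of arbitrary cardinality) and $\theta\colon A\to A$ is a function. A subalgebra is a nonempty subset closed under $\theta$, with the restricted operation; $\langle x\rangle=\{\theta^n(x): n\geq 0\}$ is the subalgebra generated by $x$. Isomorphisms are bijections commuting with the unary operations. $\mathcal{A}$ is connected if for all $x,y\in A$ there are $n,m\geq 0$ with $\theta^n(x)=\theta^m(y)$; a connected component of $\mathcal{A}$ is a maximal connected subalgebra. $\theta^{-1}(x)=\{a\in A:\theta(a)=x\}$. $\mathcal{A}$ is ultrahomogeneous if every isomorphism between finitely generated subalgebras of $\mathcal{A}$ extends to an automorphism of $\mathcal{A}$. *)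

theory Defs
  imports Main "HOL-Library.Equipollence"
begin

text \<open>
  A monounary algebra is given by a carrier set and an operation that is only
  relevant on the carrier. Hence a subalgebra is represented by its carrier, with
  the same operation: no notion below inspects the operation outside the carrier.
\<close>

definition monounary_algebra :: "'a set \<Rightarrow> ('a \<Rightarrow> 'a) \<Rightarrow> bool" where
  "monounary_algebra A \<theta> \<longleftrightarrow> A \<noteq> {} \<and> (\<forall>x\<in>A. \<theta> x \<in> A)"

definition subalgebra :: "'a set \<Rightarrow> 'a set \<Rightarrow> ('a \<Rightarrow> 'a) \<Rightarrow> bool" where
  "subalgebra B A \<theta> \<longleftrightarrow> B \<subseteq> A \<and> monounary_algebra B \<theta>"

definition generated :: "'a set \<Rightarrow> ('a \<Rightarrow> 'a) \<Rightarrow> 'a set \<Rightarrow> 'a set" where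
  "generated A \<theta> X = \<Inter> {B. subalgebra B A \<theta> \<and> X \<subseteq> B}"

definition monogenic :: "('a \<Rightarrow> 'a) \<Rightarrow> 'a \<Rightarrow> 'a set" where
  "monogenic \<theta> x = {(\<theta> ^^ n) x | n. True}"

text \<open>Subalgebras are nonempty, so a generating set has to be nonempty as well.\<close>

definition finitely_generated_subalgebra :: "'a set \<Rightarrow> 'a set \<Rightarrow> ('a \<Rightarrow> 'a) \<Rightarrow> bool" where
  "finitely_generated_subalgebra B A \<theta> \<longleftrightarrow>
     (\<exists>X. finite X \<and> X \<noteq> {} \<and> X \<subseteq> A \<and> B = generated A \<theta> X)"

definition isomorphism ::
    "('a \<Rightarrow> 'b) \<Rightarrow> 'a set \<Rightarrow> ('a \<Rightarrow> 'a) \<Rightarrow> 'b set \<Rightarrow> ('b \<Rightarrow> 'b) \<Rightarrow> bool" where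
  "isomorphism f A \<theta> B \<phi> \<longleftrightarrow> bij_betw f A B \<and> (\<forall>x\<in>A. f (\<theta> x) = \<phi> (f x))"

definition isomorphic :: "'a set \<Rightarrow> ('a \<Rightarrow> 'a) \<Rightarrow> 'b set \<Rightarrow> ('b \<Rightarrow> 'b) \<Rightarrow> bool" where
  "isomorphic A \<theta> B \<phi> \<longleftrightarrow> (\<exists>f. isomorphism f A \<theta> B \<phi>)"

definition automorphism :: "('a \<Rightarrow> 'a) \<Rightarrow> 'a set \<Rightarrow> ('a \<Rightarrow> 'a) \<Rightarrow> bool" where
  "automorphism g A \<theta> \<longleftrightarrow> isomorphism g A \<theta> A \<theta>"

definition ultrahomogeneous :: "'a set \<Rightarrow> ('a \<Rightarrow> 'a) \<Rightarrow> bool" where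
  "ultrahomogeneous A \<theta> \<longleftrightarrow>
     (\<forall>B C f. finitely_generated_subalgebra B A \<theta> \<longrightarrow>
        finitely_generated_subalgebra C A \<theta> \<longrightarrow> isomorphism f B \<theta> C \<theta> \<longrightarrow>
        (\<exists>g. automorphism g A \<theta> \<and> (\<forall>x\<in>B. g x = f x)))"

definition connected_algebra :: "'a set \<Rightarrow> ('a \<Rightarrow> 'a) \<Rightarrow> bool" where
  "connected_algebra A \<theta> \<longleftrightarrow> (\<forall>x\<in>A. \<forall>y\<in>A. \<exists>n m. (\<theta> ^^ n) x = (\<theta> ^^ m) y)"

definition algebra_component :: "'a set \<Rightarrow> 'a set \<Rightarrow> ('a \<Rightarrow> 'a) \<Rightarrow> bool" where
  "algebra_component C A \<theta> \<longleftrightarrow>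
     subalgebra C A \<theta> \<and> connected_algebra C \<theta> \<and>
     (\<forall>D. subalgebra D A \<theta> \<longrightarrow> connected_algebra D \<theta> \<longrightarrow> C \<subseteq> D \<longrightarrow> D = C)"

text \<open>The description is well defined for \<open>x \<in> A\<close>, see \<open>ex1_component\<close> below.\<close>

definition component_of :: "'a set \<Rightarrow> ('a \<Rightarrow> 'a) \<Rightarrow> 'a \<Rightarrow> 'a set" where
  "component_of A \<theta> x = (THE C. algebra_component C A \<theta> \<and> x \<in> C)"

definition preimage_in :: "'a set \<Rightarrow> ('a \<Rightarrow> 'a) \<Rightarrow> 'a \<Rightarrow> 'a set" where
  "preimage_in A \<theta> x = {a \<in> A. \<theta> a = x}"

lemma monounary_algebra_funpow:
  assumes "monounary_algebra A \<theta>" "x \<in> A"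
  shows "(\<theta> ^^ n) x \<in> A"
  using assms by (induction n) (auto simp: monounary_algebra_def)

lemma generated_singleton:
  assumes "monounary_algebra A \<theta>" "x \<in> A"
  shows "generated A \<theta> {x} = monogenic \<theta> x"
proof
  have "\<theta> y \<in> monogenic \<theta> x" if "y \<in> monogenic \<theta> x" for y
    using that unfolding monogenic_def by (auto intro: exI[of _ "Suc _"])
  moreover have "x \<in> monogenic \<theta> x"
    unfolding monogenic_def by (auto intro: exI[of _ 0])
  moreover have "monogenic \<theta> x \<subseteq> A"
    using monounary_algebra_funpow[OF assms] by (auto simp: monogenic_def)
  ultimately have "subalgebra (monogenic \<theta> x) A \<theta>" "{x} \<subseteq> monogenic \<theta> x"
    by (auto simp: subalgebra_def monounary_algebra_def)
  then show "generated A \<theta> {x} \<subseteq> monogenic \<theta> x"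
    unfolding generated_def by blast
  show "monogenic \<theta> x \<subseteq> generated A \<theta> {x}"
    unfolding generated_def monogenic_def
    by (auto simp: subalgebra_def intro: monounary_algebra_funpow)
qed

lemma funpow_meet_trans:
  fixes \<theta> :: "'a \<Rightarrow> 'a"
  assumes "(\<theta> ^^ n) x = (\<theta> ^^ m) y" "(\<theta> ^^ k) y = (\<theta> ^^ l) z"
  shows "(\<theta> ^^ (k + n)) x = (\<theta> ^^ (m + l)) z"
proof -
  have "(\<theta> ^^ (k + n)) x = (\<theta> ^^ (k + m)) y"
    by (simp add: funpow_add assms(1))
  also have "\<dots> = (\<theta> ^^ (m + k)) y"
    by (simp add: add.commute)
  also have "\<dots> = (\<theta> ^^ (m + l)) z"
    by (simp add: funpow_add assms(2))
  finally show ?thesis .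
qed

lemma ex1_component:
  assumes "monounary_algebra A \<theta>" "x \<in> A"
  shows "\<exists>!C. algebra_component C A \<theta> \<and> x \<in> C"
proof -
  define K where "K = {y \<in> A. \<exists>n m. (\<theta> ^^ n) x = (\<theta> ^^ m) y}"
  have x: "x \<in> K"
    using assms(2) unfolding K_def by blast
  have "\<theta> y \<in> K" if y: "y \<in> K" for y
  proof -
    obtain n m where "(\<theta> ^^ n) x = (\<theta> ^^ m) y"
      using y unfolding K_def by blast
    then have "(\<theta> ^^ Suc n) x = (\<theta> ^^ m) (\<theta> y)"
      by (metis funpow.simps(2) funpow_swap1 o_apply)
    then show ?thesis
      using y assms(1) unfolding K_def monounary_algebra_def by blast
  qed
  then have sub: "subalgebra K A \<theta>"
    using x by (auto simp: subalgebra_def monounary_algebra_def K_def)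
  have conn: "connected_algebra K \<theta>"
    unfolding connected_algebra_def K_def
    by simp (metis funpow_meet_trans)
  have max: "D \<subseteq> K" if "subalgebra D A \<theta>" "connected_algebra D \<theta>" "x \<in> D" for D
    using that unfolding subalgebra_def connected_algebra_def K_def by blast
  show ?thesis
  proof (rule ex1I)
    show "algebra_component K A \<theta> \<and> x \<in> K"
      using sub conn max x unfolding algebra_component_def by blast
    show "C = K" if "algebra_component C A \<theta> \<and> x \<in> C" for C
      using that sub conn max unfolding algebra_component_def by blast
  qed
qed

end

theory Submission
  imports Defs "HOL-Combinatorics.Transposition"
begin

text \<open>
  Two elements \<open>x\<close>, \<open>y\<close> generate isomorphic subalgebras iff there is an isomorphism of
  these subalgebras mapping \<open>x\<close> to \<open>y\<close>. Hence ultrahomogeneity yields an automorphism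
  mapping \<open>x\<close> to \<open>y\<close>, and it restricts to the preimages and to the components.

  Conversely, let \<open>f\<close> be an isomorphism between finitely generated subalgebras \<open>B\<close> and \<open>C\<close>.
  Every element has only finitely many preimages in \<open>B\<close>, so for \<open>b \<in> B\<close> the partial map \<open>f\<close>
  extends to a bijection between the preimages of \<open>b\<close> and of \<open>f b\<close>. Climbing up level by level,
  \<open>f\<close> extends to the components that meet \<open>B\<close>. There are finitely many of these,
  so the induced map on them extends to a permutation of all components that maps each
  component to an isomorphic one.
\<close>

section \<open>Prescribing finitely many values of a bijection\<close>

text \<open>Repair \<open>h\<close> at one point of \<open>F\<close> at a time. Applied twice below:
  to preimages with the trivially true relation, and to components with isomorphism as
  \<open>R\<close>.\<close>

lemma extend_finite_bij_betw:
  assumes "bij_betw h X Y" "finite F" "F \<subseteq> X" "inj_on f F" "f ` F \<subseteq> Y"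
    and R: "symp R" "transp R"
    and h: "\<And>x. x \<in> X \<Longrightarrow> R x (h x)" and f: "\<And>x. x \<in> F \<Longrightarrow> R x (f x)"
  shows "\<exists>k. bij_betw k X Y \<and> (\<forall>x\<in>X. R x (k x)) \<and> (\<forall>x\<in>F. k x = f x)"
  using assms(2-5) f
proof (induction F rule: finite_induct)
  case empty
  then show ?case using assms(1) h by auto
next
  case (insert a F)
  then obtain k where k: "bij_betw k X Y" "\<forall>x\<in>X. R x (k x)" "\<forall>x\<in>F. k x = f x"
    by (auto simp: inj_on_insert)
  have a: "a \<in> X" "f a \<in> Y" "R a (f a)" "R a (k a)" "k a \<in> Y"
    using insert.prems k by (auto simp: bij_betw_def)
  \<comment> \<open>Swapping \<open>k a\<close> and \<open>f a\<close> corrects the value at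
    \<open>a\<close>. A value \<open>k x = f x\<close> that is already right survives, as it differs
    from \<open>f a\<close> and from \<open>k a\<close> by injectivity. The relation survives
    because \<open>k a\<close> and \<open>f a\<close> are both related to \<open>a\<close>.\<close>
  define l where "l = transpose (k a) (f a) \<circ> k"
  have "bij_betw (transpose (k a) (f a)) Y Y"
    using a by (intro bij_betw_transpose_iff) auto
  then have "bij_betw l X Y"
    unfolding l_def using k(1) by (rule bij_betw_trans[rotated])
  moreover have "R x (l x)" if "x \<in> X" for x
  proof -
    have Rx: "R x (k x)" using k(2) that by blast
    have "R (k a) (f a)" "R (f a) (k a)"
      using a(3,4) R by (meson sympD transpD)+
    then have "k x = k a \<Longrightarrow> R x (f a)" "k x = f a \<Longrightarrow> R x (k a)"
      using Rx R(2) by (metis transpD)+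
    then show ?thesis using Rx by (simp add: l_def transpose_def)
  qed
  moreover have "l x = f x" if "x \<in> insert a F" for x
  proof (cases "x = a")
    case False
    then have x: "x \<in> F" using that by blast
    then have "f x \<noteq> f a" using insert.prems(2) False by (auto simp: inj_on_def)
    moreover have "k x \<noteq> k a"
      using k(1) x False a(1) insert.prems(1) by (auto simp: bij_betw_def inj_on_def)
    ultimately show ?thesis using k(3) x by (simp add: l_def)
  qed (simp add: l_def)
  ultimately show ?case by blast
qed

lemma isomorphism_funpow:
  assumes "isomorphism f B \<theta> C \<phi>" "\<And>x. x \<in> B \<Longrightarrow> \<theta> x \<in> B" "x \<in> B"
  shows "f ((\<theta> ^^ n) x) = (\<phi> ^^ n) (f x)" "(\<theta> ^^ n) x \<in> B"
  using assms by (induction n) (auto simp: isomorphism_def)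

section \<open>Monogenic algebras\<close>

text \<open>Isomorphism of monogenic algebras with a marked generator, expressed by coincidences of
  iterates so that no map has to be carried along.\<close>

definition same_type :: "('a \<Rightarrow> 'a) \<Rightarrow> 'a \<Rightarrow> 'a \<Rightarrow> bool" where
  "same_type \<theta> x y \<longleftrightarrow> (\<forall>n m. (\<theta> ^^ n) x = (\<theta> ^^ m) x \<longleftrightarrow> (\<theta> ^^ n) y = (\<theta> ^^ m) y)"

lemma monogenic_closed: "y \<in> monogenic \<theta> x \<Longrightarrow> \<theta> y \<in> monogenic \<theta> x"
  unfolding monogenic_def by (auto intro: exI[of _ "Suc _"])

lemma monogenic_self: "x \<in> monogenic \<theta> x"
  unfolding monogenic_def by (auto intro: exI[of _ 0])

lemma isomorphism_same_type:
  assumes f: "isomorphism f B \<theta> C \<theta>" "\<And>x. x \<in> B \<Longrightarrow> \<theta> x \<in> B" "x \<in> B"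
  shows "same_type \<theta> x (f x)"
proof -
  have "inj_on f B" using f(1) by (auto simp: isomorphism_def bij_betw_def)
  then have "(\<theta> ^^ n) x = (\<theta> ^^ m) x \<longleftrightarrow> f ((\<theta> ^^ n) x) = f ((\<theta> ^^ m) x)" for n m
    using isomorphism_funpow(2)[OF f] by (metis inj_onD)
  then show ?thesis
    by (simp add: same_type_def isomorphism_funpow(1)[OF f])
qed

lemma funpow_eq_shift:
  assumes "(\<theta> ^^ n) x = (\<theta> ^^ m) x"
  shows "(\<theta> ^^ n) ((\<theta> ^^ k) x) = (\<theta> ^^ m) ((\<theta> ^^ k) x)"
  using assms by (metis add.commute funpow_add o_apply)

text \<open>An isomorphism \<open>f\<close> need not send \<open>x\<close> to \<open>y\<close>, but
  \<open>f x\<close> and \<open>y\<close> generate the same algebra, so each is an iterate of the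
  other. Coincidences of iterates pass on to iterates, which gives \<open>f x\<close> and
  \<open>y\<close> the same type.\<close>

lemma isomorphic_monogenic_same_type:
  assumes "isomorphic (monogenic \<theta> x) \<theta> (monogenic \<theta> y) \<theta>"
  shows "same_type \<theta> x y"
proof -
  obtain f where f: "isomorphism f (monogenic \<theta> x) \<theta> (monogenic \<theta> y) \<theta>"
    using assms by (auto simp: isomorphic_def)
  have im: "f ` monogenic \<theta> x = monogenic \<theta> y"
    using f by (auto simp: isomorphism_def bij_betw_def)
  have "f x \<in> monogenic \<theta> y" using im monogenic_self by fast
  then obtain i where i: "f x = (\<theta> ^^ i) y" by (auto simp: monogenic_def)
  have "y \<in> f ` monogenic \<theta> x" using im monogenic_self by fast
  then obtain k where "y = f ((\<theta> ^^ k) x)" by (auto simp: monogenic_def)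
  then have k: "y = (\<theta> ^^ k) (f x)"
    using isomorphism_funpow(1)[OF f monogenic_closed monogenic_self] by simp
  have "same_type \<theta> x (f x)"
    by (rule isomorphism_same_type[OF f monogenic_closed monogenic_self])
  moreover have "(\<theta> ^^ n) (f x) = (\<theta> ^^ m) (f x) \<longleftrightarrow> (\<theta> ^^ n) y = (\<theta> ^^ m) y" for n m
    using funpow_eq_shift[of n \<theta> y m i] funpow_eq_shift[of n \<theta> "f x" m k]
      i k by metis
  ultimately show ?thesis by (auto simp: same_type_def)
qed

lemma same_type_isomorphism:
  assumes "same_type \<theta> x y"
  shows "\<exists>f. isomorphism f (monogenic \<theta> x) \<theta> (monogenic \<theta> y) \<theta> \<and> f x = y"
proof -
  \<comment> \<open>An element can be an iterate of \<open>x\<close> in many ways; by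
    \<open>same_type\<close> the chosen exponent does not affect the value.\<close>
  define f where "f z = (\<theta> ^^ (SOME n. z = (\<theta> ^^ n) x)) y" for z
  have f: "f ((\<theta> ^^ n) x) = (\<theta> ^^ n) y" for n
  proof -
    have "(\<theta> ^^ n) x = (\<theta> ^^ (SOME m. (\<theta> ^^ n) x = (\<theta> ^^ m) x)) x"
      by (rule someI[of "\<lambda>m. (\<theta> ^^ n) x = (\<theta> ^^ m) x"]) simp
    then show ?thesis
      using assms unfolding f_def same_type_def by metis
  qed
  have "inj_on f (monogenic \<theta> x)"
    using assms by (auto simp: inj_on_def monogenic_def f same_type_def)
  moreover have "f ` monogenic \<theta> x = monogenic \<theta> y"
    by (force simp: monogenic_def f image_iff)
  moreover have "f (\<theta> z) = \<theta> (f z)" if "z \<in> monogenic \<theta> x" for z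
    using that f[of "Suc _"] by (auto simp: monogenic_def f)
  ultimately show ?thesis
    using f[of 0] by (auto simp: isomorphism_def bij_betw_def)
qed

lemma same_type_isomorphic:
  "same_type \<theta> x y \<Longrightarrow> isomorphic (monogenic \<theta> x) \<theta> (monogenic \<theta> y) \<theta>"
  unfolding isomorphic_def by (blast dest: same_type_isomorphism)

text \<open>If the iterates of \<open>x\<close> are pairwise distinct, an element has at most one
  predecessor among them. Otherwise the orbit runs into a cycle and is finite.\<close>

lemma finite_monogenic_preimage: "finite {a \<in> monogenic \<theta> x. \<theta> a = b}"
proof (cases "inj (\<lambda>n. (\<theta> ^^ n) x)")
  case True
  have "a = c" if a: "a \<in> monogenic \<theta> x" "\<theta> a = b" and c: "c \<in> monogenic \<theta> x" "\<theta> c = b" for a c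
  proof -
    obtain n m where nm: "a = (\<theta> ^^ n) x" "c = (\<theta> ^^ m) x"
      using a c by (auto simp: monogenic_def)
    then have "(\<theta> ^^ Suc n) x = (\<theta> ^^ Suc m) x" using a c by simp
    then show ?thesis using True nm by (metis injD nat.inject)
  qed
  then have "\<exists>c. {a \<in> monogenic \<theta> x. \<theta> a = b} \<subseteq> {c}"
    by (cases "{a \<in> monogenic \<theta> x. \<theta> a = b} = {}") blast+
  then show ?thesis
    by (meson finite.emptyI finite_insert finite_subset)
next
  case False
  then obtain i j where ij: "i < j" "(\<theta> ^^ i) x = (\<theta> ^^ j) x"
    unfolding inj_def by (metis linorder_neqE_nat)
  \<comment> \<open>An exponent \<open>n\<close> with \<open>n \<ge> j\<close> can be lowered to
    \<open>n - j + i\<close> without changing the iterate.\<close>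
  have "(\<theta> ^^ n) x \<in> (\<lambda>n. (\<theta> ^^ n) x) ` {..<j}" for n
  proof (induction n rule: less_induct)
    case (less n)
    show ?case
    proof (cases "n < j")
      case False
      then have "(\<theta> ^^ n) x = (\<theta> ^^ (n - j)) ((\<theta> ^^ j) x)"
        by (metis funpow_add le_add_diff_inverse2 not_less o_apply)
      also have "\<dots> = (\<theta> ^^ (n - j + i)) x"
        by (simp add: ij(2)[symmetric] funpow_add)
      finally show ?thesis using less[of "n - j + i"] False ij(1) by simp
    qed auto
  qed
  then have "monogenic \<theta> x \<subseteq> (\<lambda>n. (\<theta> ^^ n) x) ` {..<j}"
    unfolding monogenic_def by blast
  then have "finite (monogenic \<theta> x)"
    by (meson finite_imageI finite_lessThan finite_subset)
  then show ?thesis by simp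
qed

lemma generated_eq_Union_monogenic:
  assumes "monounary_algebra A \<theta>" "X \<subseteq> A" "X \<noteq> {}"
  shows "generated A \<theta> X = (\<Union>x\<in>X. monogenic \<theta> x)"
proof
  have "monogenic \<theta> x \<subseteq> B" if "subalgebra B A \<theta>" "x \<in> B" for B x
    using that monounary_algebra_funpow[of B \<theta> x] by (auto simp: subalgebra_def monogenic_def)
  then show "(\<Union>x\<in>X. monogenic \<theta> x) \<subseteq> generated A \<theta> X"
    unfolding generated_def by blast
  have "monogenic \<theta> x \<subseteq> A" if "x \<in> X" for x
    using that assms(1,2) monounary_algebra_funpow[of A \<theta> x] by (auto simp: monogenic_def)
  then have "subalgebra (\<Union>x\<in>X. monogenic \<theta> x) A \<theta>"
    using assms(3) monogenic_self monogenic_closed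
    by (fastforce simp: subalgebra_def monounary_algebra_def)
  moreover have "X \<subseteq> (\<Union>x\<in>X. monogenic \<theta> x)" using monogenic_self by fast
  ultimately show "generated A \<theta> X \<subseteq> (\<Union>x\<in>X. monogenic \<theta> x)"
    unfolding generated_def by blast
qed

section \<open>Components\<close>

definition conn :: "('a \<Rightarrow> 'a) \<Rightarrow> 'a \<Rightarrow> 'a \<Rightarrow> bool" where
  "conn \<theta> x y \<longleftrightarrow> (\<exists>n m. (\<theta> ^^ n) x = (\<theta> ^^ m) y)"

text \<open>Explicit form of a component; \<open>component_of_eq\<close> uses it to eliminate the
  description operator.\<close>

definition conn_class :: "'a set \<Rightarrow> ('a \<Rightarrow> 'a) \<Rightarrow> 'a \<Rightarrow> 'a set" where
  "conn_class A \<theta> x = {y \<in> A. conn \<theta> x y}"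

lemma conn_refl: "conn \<theta> x x"
  unfolding conn_def by blast

lemma conn_sym: "conn \<theta> x y \<Longrightarrow> conn \<theta> y x"
  unfolding conn_def by metis

lemma conn_trans: "conn \<theta> x y \<Longrightarrow> conn \<theta> y z \<Longrightarrow> conn \<theta> x z"
  unfolding conn_def by (metis funpow_meet_trans)

lemma conn_funpow: "conn \<theta> x ((\<theta> ^^ n) x)"
  unfolding conn_def by (metis funpow_0)

lemma conn_step: "conn \<theta> x (\<theta> x)"
  using conn_funpow[of \<theta> x 1] by simp

lemma conn_class_eq: "conn \<theta> x y \<Longrightarrow> conn_class A \<theta> x = conn_class A \<theta> y"
  unfolding conn_class_def by (blast intro: conn_sym conn_trans)

lemma conn_class_self: "x \<in> A \<Longrightarrow> x \<in> conn_class A \<theta> x"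
  by (simp add: conn_class_def conn_refl)

lemma conn_class_eqD: "y \<in> A \<Longrightarrow> conn_class A \<theta> x = conn_class A \<theta> y \<Longrightarrow> conn \<theta> x y"
  using conn_class_self unfolding conn_class_def by fastforce

lemma component_of_eq:
  assumes "monounary_algebra A \<theta>" "x \<in> A"
  shows "component_of A \<theta> x = conn_class A \<theta> x"
proof -
  let ?K = "conn_class A \<theta> x"
  have "subalgebra ?K A \<theta>"
    using assms unfolding subalgebra_def monounary_algebra_def conn_class_def
    by (auto intro: conn_refl conn_trans conn_step)
  moreover have "connected_algebra ?K \<theta>"
    unfolding connected_algebra_def conn_class_def conn_def[symmetric]
    by (blast intro: conn_sym conn_trans)
  moreover have "x \<in> ?K" by (rule conn_class_self[OF assms(2)])
  moreover have "D = ?K" if "subalgebra D A \<theta>" "connected_algebra D \<theta>" "?K \<subseteq> D" for D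
    using that \<open>x \<in> ?K\<close>
    unfolding subalgebra_def connected_algebra_def conn_class_def conn_def[symmetric] by blast
  ultimately have "algebra_component ?K A \<theta> \<and> x \<in> ?K"
    unfolding algebra_component_def by blast
  then show ?thesis
    unfolding component_of_def by (rule the1_equality[OF ex1_component[OF assms]])
qed

text \<open>All iterates stay in \<open>B\<close>, where \<open>f\<close> is injective, so meeting
  of orbits is reflected as well as preserved.\<close>

lemma isomorphism_conn:
  assumes f: "isomorphism f B \<theta> C \<theta>" "\<And>x. x \<in> B \<Longrightarrow> \<theta> x \<in> B" and "x \<in> B" "y \<in> B"
  shows "conn \<theta> (f x) (f y) \<longleftrightarrow> conn \<theta> x y"
proof -
  have "inj_on f B" using f(1) by (auto simp: isomorphism_def bij_betw_def)
  then have "f ((\<theta> ^^ n) x) = f ((\<theta> ^^ m) y) \<longleftrightarrow> (\<theta> ^^ n) x = (\<theta> ^^ m) y" for n m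
    using isomorphism_funpow(2)[OF f] assms(3,4) by (metis inj_onD)
  then show ?thesis
    unfolding conn_def by (simp add: isomorphism_funpow(1)[OF f] assms(3,4))
qed

text \<open>Serves to cut a partial isomorphism into pieces inside single components, and, with
  \<open>B\<close> and \<open>C\<close> equal to \<open>A\<close>, to restrict an automorphism to a
  component.\<close>

lemma isomorphism_conn_class:
  assumes f: "isomorphism f B \<theta> C \<theta>" "\<And>x. x \<in> B \<Longrightarrow> \<theta> x \<in> B" and "x \<in> B"
    and "B \<subseteq> A" "C \<subseteq> A"
  shows "isomorphism f (B \<inter> conn_class A \<theta> x) \<theta> (C \<inter> conn_class A \<theta> (f x)) \<theta>"
proof -
  have im: "f ` B = C" and inj: "inj_on f B"
    using f(1) by (auto simp: isomorphism_def bij_betw_def)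
  have "f ` (B \<inter> conn_class A \<theta> x) = C \<inter> conn_class A \<theta> (f x)"
    using isomorphism_conn[OF f \<open>x \<in> B\<close>] assms(4,5) im unfolding conn_class_def by blast
  moreover have "inj_on f (B \<inter> conn_class A \<theta> x)"
    using inj by (rule inj_on_subset) blast
  ultimately show ?thesis
    using f(1) by (auto simp: isomorphism_def bij_betw_def)
qed

section \<open>Climbing up\<close>

definition upward :: "'a set \<Rightarrow> ('a \<Rightarrow> 'a) \<Rightarrow> 'a set \<Rightarrow> 'a set" where
  "upward A \<theta> B = {y \<in> A. \<exists>n. (\<theta> ^^ n) y \<in> B}"

text \<open>Whatever is connected to \<open>b\<close> runs into the forward orbit of
  \<open>b\<close>, which stays in \<open>B\<close>. Hence maps extended to upward sets cover whole
  components.\<close>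

lemma upward_conn_class:
  assumes "B \<subseteq> A" "\<And>x. x \<in> B \<Longrightarrow> \<theta> x \<in> B" "b \<in> B"
  shows "upward A \<theta> (B \<inter> conn_class A \<theta> b) = conn_class A \<theta> b"
proof
  show "upward A \<theta> (B \<inter> conn_class A \<theta> b) \<subseteq> conn_class A \<theta> b"
    unfolding upward_def conn_class_def by (auto intro: conn_trans[OF _ conn_sym[OF conn_funpow]])
  show "conn_class A \<theta> b \<subseteq> upward A \<theta> (B \<inter> conn_class A \<theta> b)"
  proof
    fix y assume y: "y \<in> conn_class A \<theta> b"
    then obtain n m where nm: "(\<theta> ^^ n) b = (\<theta> ^^ m) y"
      by (auto simp: conn_class_def conn_def)
    have "(\<theta> ^^ n) b \<in> B" using assms(2,3) by (induction n) auto
    then show "y \<in> upward A \<theta> (B \<inter> conn_class A \<theta> b)"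
      using nm y assms(1) conn_funpow[of \<theta> b n] by (auto simp: upward_def conn_class_def)
  qed
qed

text \<open>Induction on the number of steps that lead from \<open>y\<close> into
  \<open>B\<close>.\<close>

lemma upward_induct [consumes 1, case_names closed base step]:
  assumes "y \<in> upward A \<theta> B" and closed: "\<And>x. x \<in> A \<Longrightarrow> \<theta> x \<in> A"
    and base: "\<And>y. y \<in> A \<Longrightarrow> y \<in> B \<Longrightarrow> P y"
    and step: "\<And>y. y \<in> A \<Longrightarrow> y \<notin> B \<Longrightarrow> \<theta> y \<in> upward A \<theta> B \<Longrightarrow> P (\<theta> y) \<Longrightarrow> P y"
  shows "P y"
proof -
  obtain n where "(\<theta> ^^ n) y \<in> B" "y \<in> A" using assms(1) by (auto simp: upward_def)
  then show ?thesis
  proof (induction n arbitrary: y)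
    case (Suc n)
    then have "(\<theta> ^^ n) (\<theta> y) \<in> B" "\<theta> y \<in> A"
      using closed by (auto simp: funpow_swap1)
    with Suc show ?case using base step unfolding upward_def by blast
  qed (auto intro: base)
qed

text \<open>A coincidence of two positive iterates of \<open>y\<close> is one of iterates of
  \<open>\<theta> y\<close>; a coincidence of \<open>y\<close> itself with a positive iterate is
  excluded by non-periodicity.\<close>

lemma same_type_step:
  assumes "same_type \<theta> (\<theta> y) (\<theta> z)"
    and "\<And>n. (\<theta> ^^ Suc n) y \<noteq> y" "\<And>n. (\<theta> ^^ Suc n) z \<noteq> z"
  shows "same_type \<theta> y z"
  unfolding same_type_def
proof (intro allI)
  fix n m
  have S: "(\<theta> ^^ Suc n) x = (\<theta> ^^ n) (\<theta> x)" for n x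
    by (simp add: funpow_swap1)
  show "(\<theta> ^^ n) y = (\<theta> ^^ m) y \<longleftrightarrow> (\<theta> ^^ n) z = (\<theta> ^^ m) z"
  proof (cases n; cases m)
    fix n' m' assume "n = Suc n'" "m = Suc m'"
    then show ?thesis using assms(1) by (simp add: same_type_def S del: funpow.simps)
  qed (use assms(2,3) in \<open>metis funpow_0\<close>)+
qed

text \<open>A periodic point comes back from each of its iterates, so the closed set
  \<open>B\<close> would contain it.\<close>

lemma upward_not_periodic:
  assumes "y \<in> upward A \<theta> B" "y \<notin> B" "\<And>x. x \<in> B \<Longrightarrow> \<theta> x \<in> B"
  shows "(\<theta> ^^ Suc n) y \<noteq> y"
proof
  assume y: "(\<theta> ^^ Suc n) y = y"
  obtain k where k: "(\<theta> ^^ k) y \<in> B" using assms(1) by (auto simp: upward_def)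
  have "(\<theta> ^^ (j + k)) y \<in> B" for j
    using k assms(3) by (induction j) auto
  \<comment> \<open>With \<open>n * k\<close> further steps the total is \<open>Suc n * k\<close>, a
    whole number of rounds.\<close>
  from this[of "n * k"] have "(\<theta> ^^ (Suc n * k)) y \<in> B" by (simp add: add.commute)
  moreover have "(\<theta> ^^ (Suc n * k)) y = y"
    unfolding funpow_mult[symmetric] using y by (induction k) simp_all
  ultimately show False using assms(2) by simp
qed

text \<open>Once \<open>g b\<close> is known and has the type of \<open>b\<close>, the preimages of
  both are equipollent, so \<open>g\<close> can be continued to them, in agreement with
  \<open>f\<close> by finiteness of the fibres in \<open>B\<close>. Outside \<open>B\<close> and
  \<open>C\<close> nothing is periodic, so types keep agreeing one level higher.\<close>

lemma extend_upward:
  assumes closed: "\<And>x. x \<in> A \<Longrightarrow> \<theta> x \<in> A"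
    and B: "B \<subseteq> A" "\<And>x. x \<in> B \<Longrightarrow> \<theta> x \<in> B"
    and C: "C \<subseteq> A" "\<And>x. x \<in> C \<Longrightarrow> \<theta> x \<in> C"
    and f: "isomorphism f B \<theta> C \<theta>"
    and fin: "\<And>b. finite {a \<in> B. \<theta> a = b}"
    and pre: "\<And>x y. x \<in> A \<Longrightarrow> y \<in> A \<Longrightarrow> same_type \<theta> x y \<Longrightarrow>
      preimage_in A \<theta> x \<approx> preimage_in A \<theta> y"
  shows "\<exists>g. isomorphism g (upward A \<theta> B) \<theta> (upward A \<theta> C) \<theta> \<and> (\<forall>x\<in>B. g x = f x)"
proof -
  let ?P = "preimage_in A \<theta>" and ?U = "upward A \<theta> B" and ?V = "upward A \<theta> C"
  have fB: "inj_on f B" "f ` B = C" "\<And>x. x \<in> B \<Longrightarrow> f (\<theta> x) = \<theta> (f x)"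
    using f by (auto simp: isomorphism_def bij_betw_def)
  have closedU: "\<theta> y \<in> ?U" if yU: "y \<in> ?U" for y
  proof (cases "y \<in> B")
    case True
    then have "(\<theta> ^^ 0) (\<theta> y) \<in> B" "\<theta> y \<in> A" using B by auto
    then show ?thesis unfolding upward_def by blast
  next
    case False
    obtain n where n: "(\<theta> ^^ n) y \<in> B" "y \<in> A" using yU by (auto simp: upward_def)
    then obtain m where "n = Suc m" using False by (cases n) auto
    then have "(\<theta> ^^ m) (\<theta> y) \<in> B" using n by (simp add: funpow_swap1)
    then show ?thesis using closed n(2) by (auto simp: upward_def)
  qed
  have upI: "y \<in> upward A \<theta> D" if y: "y \<in> A" "\<theta> y \<in> upward A \<theta> D" for y D
  proof -
    obtain n where "(\<theta> ^^ n) (\<theta> y) \<in> D" using y(2) by (auto simp: upward_def)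
    then have "(\<theta> ^^ Suc n) y \<in> D" by (simp add: funpow_swap1)
    then show ?thesis using y(1) unfolding upward_def by blast
  qed
  have subU: "D \<subseteq> upward A \<theta> D" if "D \<subseteq> A" for D
    using that by (force simp: upward_def intro: exI[of _ 0])
  \<comment> \<open>Admissible bijections between two fibres; agreement with \<open>f\<close> is
    demanded only where \<open>f\<close> itself takes \<open>b\<close> to \<open>c\<close>.\<close>
  define Q where "Q b c k \<longleftrightarrow> bij_betw k (?P b) (?P c) \<and>
    (b \<in> B \<and> c = f b \<longrightarrow> (\<forall>y\<in>?P b \<inter> B. k y = f y))" for b c k
  \<comment> \<open>One fixed choice per pair, so that all preimages of \<open>b\<close> are moved
    by the same bijection.\<close>
  define H where "H b c = (SOME k. Q b c k)" for b c
  have H: "Q b c (H b c)" if bc: "b \<in> A" "c \<in> A" "same_type \<theta> b c" for b c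
  proof -
    obtain h where h: "bij_betw h (?P b) (?P c)"
      using pre[OF bc] by (auto simp: eqpoll_def)
    have "\<exists>k. Q b c k"
    proof (cases "b \<in> B \<and> c = f b")
      case True
      have "finite (?P b \<inter> B)"
        by (rule finite_subset[OF _ fin[of b]]) (auto simp: preimage_in_def)
      moreover have "inj_on f (?P b \<inter> B)" using fB(1) by (auto intro: inj_on_subset)
      moreover have "f ` (?P b \<inter> B) \<subseteq> ?P c"
        using fB C(1) True by (fastforce simp: preimage_in_def)
      ultimately show ?thesis
        using extend_finite_bij_betw[OF h, of "?P b \<inter> B" f "\<lambda>_ _. True"]
        by (auto simp: Q_def symp_def transp_def)
    qed (use h in \<open>auto simp: Q_def\<close>)
    then show ?thesis unfolding H_def by (rule someI_ex)
  qed
  \<comment> \<open>As \<open>g y\<close> depends on \<open>g (\<theta> y)\<close>, the recursion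
    runs on the distance to \<open>B\<close>; \<open>G n\<close> serves the elements at distance
    \<open>n\<close>, starting from \<open>f\<close>.\<close>
  define lev where "lev y = (LEAST n. (\<theta> ^^ n) y \<in> B)" for y
  define G where "G = rec_nat f (\<lambda>_ r y. H (\<theta> y) (r (\<theta> y)) y)"
  define g where "g y = G (lev y) y" for y
  have gB: "g y = f y" if "y \<in> B" for y
  proof -
    have "lev y = 0" using that by (simp add: lev_def)
    then show ?thesis by (simp add: g_def G_def)
  qed
  have gU: "g y = H (\<theta> y) (g (\<theta> y)) y" if y: "y \<in> ?U" "y \<notin> B" for y
  proof -
    obtain n where "(\<theta> ^^ n) y \<in> B" using y by (auto simp: upward_def)
    then have "lev y = Suc (LEAST n. (\<theta> ^^ Suc n) y \<in> B)"
      unfolding lev_def using y(2) by (intro Least_Suc) auto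
    then have "lev y = Suc (lev (\<theta> y))" by (simp add: lev_def funpow_swap1)
    then show ?thesis by (simp add: g_def G_def)
  qed
  \<comment> \<open>The equivalence \<open>g y \<in> C \<longleftrightarrow> y \<in> B\<close> is
    carried along because it makes \<open>g y\<close> non-periodic when \<open>y\<close> is outside
    \<open>B\<close>, as the type argument requires.\<close>
  have main: "g y \<in> ?V \<and> same_type \<theta> y (g y) \<and> (g y \<in> C \<longleftrightarrow> y \<in> B) \<and> g (\<theta> y) = \<theta> (g y)"
    if "y \<in> ?U" for y
    using that
  proof (induction y rule: upward_induct)
    case (closed x)
    then show ?case by (rule assms(1))
  next
    case (base y)
    then have "g y = f y" "g (\<theta> y) = f (\<theta> y)" using gB B(2) by auto
    moreover have "f y \<in> C" using base fB(2) by blast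
    moreover have "same_type \<theta> y (f y)"
      by (rule isomorphism_same_type[OF f B(2) base(2)])
    ultimately show ?case using base(2) fB(3) subU[OF C(1)] by auto
  next
    case (step y)
    let ?b = "\<theta> y" and ?c = "g (\<theta> y)"
    have yU: "y \<in> ?U" using upI step by blast
    have b: "?b \<in> A" "?c \<in> A" "same_type \<theta> ?b ?c" using step by (auto simp: upward_def)
    have Q: "Q ?b ?c (H ?b ?c)" using H[OF b] .
    have gy: "g y = H ?b ?c y" by (rule gU[OF yU step(2)])
    have yP: "y \<in> ?P ?b" using step(1) by (simp add: preimage_in_def)
    then have "g y \<in> ?P ?c" using Q by (auto simp: gy Q_def bij_betw_def)
    then have gP: "g y \<in> A" "\<theta> (g y) = ?c" by (auto simp: preimage_in_def)
    then have V: "g y \<in> ?V" using upI step by simp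
    \<comment> \<open>Otherwise \<open>g y = f z\<close> with \<open>z\<close> in \<open>B\<close>
      lying in the same fibre as \<open>y\<close>. There \<open>H\<close> agrees with
      \<open>f\<close> at \<open>z\<close> and is injective, which forces
      \<open>z = y\<close>.\<close>
    have nC: "g y \<notin> C"
    proof
      assume gC: "g y \<in> C"
      then have "?c \<in> C" using C(2) gP by metis
      then have bB: "?b \<in> B" using step by blast
      obtain z where z: "z \<in> B" "g y = f z" using gC fB(2) by blast
      have "f (\<theta> z) = f ?b" using z fB(3) gP gB[OF bB] by metis
      then have "\<theta> z = ?b" using fB(1) z B(2) bB by (auto dest: inj_onD)
      then have zP: "z \<in> ?P ?b" using z B(1) by (auto simp: preimage_in_def)
      then have "H ?b ?c z = f z" using Q z bB gB[OF bB] by (auto simp: Q_def)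
      then have "H ?b ?c z = H ?b ?c y" using gy z by simp
      then have "z = y" using Q yP zP by (auto simp: Q_def bij_betw_def dest: inj_onD)
      then show False using z step by blast
    qed
    have "same_type \<theta> y (g y)"
    proof (rule same_type_step)
      show "same_type \<theta> (\<theta> y) (\<theta> (g y))" using b gP by simp
      show "(\<theta> ^^ Suc n) y \<noteq> y" for n
        by (rule upward_not_periodic[OF yU step(2) B(2)])
      show "(\<theta> ^^ Suc n) (g y) \<noteq> g y" for n
        by (rule upward_not_periodic[OF V nC C(2)])
    qed
    then show ?case using V nC gP step(2) by simp
  qed
  \<comment> \<open>The recursion equation holds on \<open>B\<close> too, as \<open>H\<close>
    extends \<open>f\<close> there. So on each entire fibre \<open>g\<close> is a single
    bijection.\<close>
  have gH: "g y = H (\<theta> y) (g (\<theta> y)) y" if y: "y \<in> ?U" for y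
  proof (cases "y \<in> B")
    case True
    then have b: "\<theta> y \<in> B" "g (\<theta> y) = f (\<theta> y)" using B gB by auto
    have "Q (\<theta> y) (g (\<theta> y)) (H (\<theta> y) (g (\<theta> y)))"
      using main[OF closedU[OF y]] closedU[OF y] by (intro H) (auto simp: upward_def)
    then show ?thesis
      using b True B(1) gB[OF True] by (auto simp: Q_def preimage_in_def)
  qed (rule gU[OF y])
  have bij: "bij_betw (H b (g b)) (?P b) (?P (g b))" if "b \<in> ?U" for b
    using H[of b "g b"] main[OF that] that by (auto simp: upward_def Q_def)
  \<comment> \<open>Equal images have equal successors, so the induction hypothesis puts
    \<open>y\<close> and \<open>z\<close> into one fibre.\<close>
  have inj: "z \<in> ?U \<Longrightarrow> g y = g z \<Longrightarrow> y = z" if "y \<in> ?U" for y z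
    using that
  proof (induction y arbitrary: z rule: upward_induct)
    case (closed x)
    then show ?case by (rule assms(1))
  next
    case (base y)
    then have "z \<in> B" using main gB subU[OF B(1)] by (metis subsetD)
    then show ?case using base fB(1) gB by (auto dest: inj_onD)
  next
    case (step y)
    have yU: "y \<in> ?U" using upI step by blast
    have "g (\<theta> y) = g (\<theta> z)" using main yU step.prems by metis
    then have eq: "\<theta> y = \<theta> z" using step closedU by blast
    have "y \<in> ?P (\<theta> y)" "z \<in> ?P (\<theta> y)"
      using yU step.prems eq by (auto simp: preimage_in_def upward_def)
    moreover have "H (\<theta> y) (g (\<theta> y)) y = H (\<theta> y) (g (\<theta> y)) z"
      using gH[OF yU] gH[OF step.prems(1)] eq step.prems(2) by simp
    ultimately show ?case using bij[OF step(3)] by (auto simp: bij_betw_def dest: inj_onD)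
  qed
  \<comment> \<open>Induction on the distance to \<open>C\<close>: lift \<open>\<theta> z\<close> to
    some \<open>b\<close> first, then \<open>z\<close> to the fibre over \<open>b\<close>.\<close>
  have surj: "\<exists>y\<in>?U. g y = z" if "z \<in> ?V" for z
    using that
  proof (induction z rule: upward_induct)
    case (closed x)
    then show ?case by (rule assms(1))
  next
    case (base z)
    then obtain y where "y \<in> B" "f y = z" using fB(2) by blast
    then show ?case using gB subU[OF B(1)] by blast
  next
    case (step z)
    then obtain b where b: "b \<in> ?U" "g b = \<theta> z" by blast
    then have "z \<in> ?P (g b)" using step by (simp add: preimage_in_def)
    then obtain y where y: "y \<in> ?P b" "H b (g b) y = z"
      using bij[OF b(1)] by (metis bij_betw_imp_surj_on imageE)
    then have "\<theta> y = b" "y \<in> ?U" using upI b by (auto simp: preimage_in_def)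
    then show ?case using gH y by metis
  qed
  have "bij_betw g ?U ?V"
    unfolding bij_betw_def inj_on_def using inj surj main by blast
  then show ?thesis using main gB by (auto simp: isomorphism_def)
qed

section \<open>From components to the algebra\<close>

lemma automorphism_preimage_eqpoll:
  assumes "monounary_algebra A \<theta>" and g: "automorphism g A \<theta>" and "x \<in> A"
  shows "preimage_in A \<theta> x \<approx> preimage_in A \<theta> (g x)"
proof -
  have g': "inj_on g A" "g ` A = A" "\<And>y. y \<in> A \<Longrightarrow> g (\<theta> y) = \<theta> (g y)"
    using g by (auto simp: automorphism_def isomorphism_def bij_betw_def)
  have A: "\<theta> y \<in> A" if "y \<in> A" for y using that assms(1) by (auto simp: monounary_algebra_def)
  have "g ` preimage_in A \<theta> x = preimage_in A \<theta> (g x)"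
  proof
    show "g ` preimage_in A \<theta> x \<subseteq> preimage_in A \<theta> (g x)"
      using g' by (force simp: preimage_in_def)
    show "preimage_in A \<theta> (g x) \<subseteq> g ` preimage_in A \<theta> x"
    proof
      fix z assume z: "z \<in> preimage_in A \<theta> (g x)"
      then obtain y where y: "y \<in> A" "z = g y" using g'(2) by (auto simp: preimage_in_def)
      then have "g (\<theta> y) = g x" using z g'(3) by (auto simp: preimage_in_def)
      then have "\<theta> y = x" using g'(1) A y \<open>x \<in> A\<close> by (auto dest: inj_onD)
      then show "z \<in> g ` preimage_in A \<theta> x" using y by (auto simp: preimage_in_def)
    qed
  qed
  moreover have "inj_on g (preimage_in A \<theta> x)"
    using g'(1) by (rule inj_on_subset) (auto simp: preimage_in_def)
  ultimately show ?thesis unfolding eqpoll_def bij_betw_def by blast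
qed

lemma isomorphic_refl: "isomorphic X \<theta> X \<theta>"
  unfolding isomorphic_def isomorphism_def by (intro exI[of _ id]) auto

lemma isomorphic_trans:
  assumes "isomorphic X \<theta> Y \<theta>" "isomorphic Y \<theta> Z \<theta>"
  shows "isomorphic X \<theta> Z \<theta>"
proof -
  obtain f g where fg: "isomorphism f X \<theta> Y \<theta>" "isomorphism g Y \<theta> Z \<theta>"
    using assms by (auto simp: isomorphic_def)
  have "bij_betw (g \<circ> f) X Z"
    using fg by (auto simp: isomorphism_def intro: bij_betw_trans)
  moreover have "(g \<circ> f) (\<theta> x) = \<theta> ((g \<circ> f) x)" if "x \<in> X" for x
    using fg that by (auto simp: isomorphism_def bij_betw_def)
  ultimately show ?thesis unfolding isomorphic_def isomorphism_def by blast
qed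

text \<open>The component of an image point is \<open>\<pi>\<close> of the original component, so
  the permutation \<open>\<pi>\<close> reduces bijectivity to single components. The operation never
  leaves a component, so one \<open>e K\<close> handles both \<open>x\<close> and
  \<open>\<theta> x\<close>.\<close>

lemma glue_components:
  assumes A: "monounary_algebra A \<theta>"
    and \<pi>: "bij_betw \<pi> (conn_class A \<theta> ` A) (conn_class A \<theta> ` A)"
    and e: "\<And>K. K \<in> conn_class A \<theta> ` A \<Longrightarrow> isomorphism (e K) K \<theta> (\<pi> K) \<theta>"
  shows "automorphism (\<lambda>x. e (conn_class A \<theta> x) x) A \<theta>"
proof -
  let ?k = "conn_class A \<theta>"
  let ?g = "\<lambda>x. e (?k x) x"
  have kK: "?k y = K" if "y \<in> K" "K \<in> ?k ` A" for y K
    using that conn_class_eq[of \<theta> _ y A] by (auto simp: conn_class_def[of A \<theta>])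
  have KA: "K \<subseteq> A" if "K \<in> ?k ` A" for K using that by (auto simp: conn_class_def)
  have \<pi>A: "\<pi> K \<in> ?k ` A" if "K \<in> ?k ` A" for K using \<pi> that by (auto simp: bij_betw_def)
  have gin: "?g x \<in> \<pi> (?k x)" if "x \<in> A" for x
    using e[of "?k x"] that conn_class_self[OF that] by (auto simp: isomorphism_def bij_betw_def)
  have gA: "?g x \<in> A" if "x \<in> A" for x
    using gin[OF that] KA[OF \<pi>A[of "?k x"]] that by blast
  have "x = y" if xy: "x \<in> A" "y \<in> A" "?g x = ?g y" for x y
  proof -
    have "\<pi> (?k x) = ?k (?g x)" "\<pi> (?k y) = ?k (?g y)"
      using kK[OF gin \<pi>A] xy(1,2) by blast+
    then have "\<pi> (?k x) = \<pi> (?k y)" using xy by simp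
    then have eq: "?k x = ?k y" using \<pi> xy by (auto simp: bij_betw_def dest: inj_onD)
    have "inj_on (e (?k x)) (?k x)"
      using e[of "?k x"] xy by (auto simp: isomorphism_def bij_betw_def)
    then show ?thesis
      using conn_class_self[OF xy(1)] conn_class_self[OF xy(2)] xy(3) eq
      by (metis inj_onD)
  qed
  then have "inj_on ?g A" by (auto simp: inj_on_def)
  moreover have "z \<in> ?g ` A" if z: "z \<in> A" for z
  proof -
    obtain K where K: "K \<in> ?k ` A" "\<pi> K = ?k z"
      using \<pi> z unfolding bij_betw_def by (metis imageE imageI)
    have "e K ` K = ?k z" using e[OF K(1)] K(2) by (auto simp: isomorphism_def bij_betw_def)
    then obtain y where y: "y \<in> K" "z = e K y" using conn_class_self[OF z] by blast
    have "?g y = z" using kK[OF y(1) K(1)] y(2) by simp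
    moreover have "y \<in> A" using KA[OF K(1)] y(1) by blast
    ultimately show ?thesis by blast
  qed
  moreover have "?g (\<theta> x) = \<theta> (?g x)" if x: "x \<in> A" for x
  proof -
    have "?k (\<theta> x) = ?k x" by (metis conn_class_eq conn_step)
    then show ?thesis
      using e[of "?k x"] x conn_class_self[OF x] by (auto simp: isomorphism_def)
  qed
  ultimately show ?thesis
    using gA by (auto simp: automorphism_def isomorphism_def bij_betw_def)
qed

section \<open>Ultrahomogeneity from preimages and components\<close>

lemma ultrahomogeneous_if:
  assumes A: "monounary_algebra A \<theta>"
    and pre: "\<And>x y. x \<in> A \<Longrightarrow> y \<in> A \<Longrightarrow> same_type \<theta> x y \<Longrightarrow>
      preimage_in A \<theta> x \<approx> preimage_in A \<theta> y"
    and iso: "\<And>x y. x \<in> A \<Longrightarrow> y \<in> A \<Longrightarrow> same_type \<theta> x y \<Longrightarrow>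
      isomorphic (conn_class A \<theta> x) \<theta> (conn_class A \<theta> y) \<theta>"
  shows "ultrahomogeneous A \<theta>"
  unfolding ultrahomogeneous_def
proof (intro allI impI)
  fix B C f
  assume fgB: "finitely_generated_subalgebra B A \<theta>" and fgC: "finitely_generated_subalgebra C A \<theta>"
    and f: "isomorphism f B \<theta> C \<theta>"
  let ?k = "conn_class A \<theta>"
  have closed: "\<theta> x \<in> A" if "x \<in> A" for x using that A by (auto simp: monounary_algebra_def)
  \<comment> \<open>Finiteness of the generating set enters here: each component met by
    \<open>D\<close> contains a generator, and each fibre is a finite union of fibres in monogenic
    algebras.\<close>
  have fg: "D \<subseteq> A \<and> (\<forall>x\<in>D. \<theta> x \<in> D) \<and> finite (?k ` D) \<and> (\<forall>b. finite {a\<in>D. \<theta> a = b})"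
    if D: "finitely_generated_subalgebra D A \<theta>" for D
  proof -
    obtain X where X: "finite X" "X \<noteq> {}" "X \<subseteq> A" "D = generated A \<theta> X"
      using D by (auto simp: finitely_generated_subalgebra_def)
    have D: "D = (\<Union>x\<in>X. monogenic \<theta> x)"
      using generated_eq_Union_monogenic[OF A] X by simp
    have "D \<subseteq> A"
      using monounary_algebra_funpow[OF A] X(3) by (auto simp: D monogenic_def)
    moreover have "\<theta> x \<in> D" if "x \<in> D" for x
      using that by (auto simp: D intro: monogenic_closed)
    moreover have "?k y \<in> ?k ` X" if y: "y \<in> D" for y
    proof -
      obtain x n where "x \<in> X" "y = (\<theta> ^^ n) x" using y by (auto simp: D monogenic_def)
      then show ?thesis using conn_class_eq[OF conn_funpow] by (metis imageI)
    qed
    then have "finite (?k ` D)"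
      using X(1) by (meson finite_imageI finite_subset image_subsetI)
    moreover have "{a \<in> D. \<theta> a = b} = (\<Union>x\<in>X. {a \<in> monogenic \<theta> x. \<theta> a = b})" for b
      by (auto simp: D)
    then have "finite {a \<in> D. \<theta> a = b}" for b
      using X(1) by (simp add: finite_monogenic_preimage)
    ultimately show ?thesis by blast
  qed
  have B: "B \<subseteq> A" "\<And>x. x \<in> B \<Longrightarrow> \<theta> x \<in> B" "finite (?k ` B)" "\<And>b. finite {a\<in>B. \<theta> a = b}"
    using fg[OF fgB] by auto
  have C: "C \<subseteq> A" "\<And>x. x \<in> C \<Longrightarrow> \<theta> x \<in> C"
    using fg[OF fgC] by auto
  have fC: "f b \<in> C" "f b \<in> A" if "b \<in> B" for b
    using f C(1) that by (auto simp: isomorphism_def bij_betw_def)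
  define \<sigma> where "\<sigma> K = ?k (f (SOME b. b \<in> B \<and> ?k b = K))" for K
  have \<sigma>: "\<sigma> (?k b) = ?k (f b)" if b: "b \<in> B" for b
  proof -
    let ?b = "SOME c. c \<in> B \<and> ?k c = ?k b"
    have c: "?b \<in> B \<and> ?k ?b = ?k b" by (rule someI[of _ b]) (simp add: b)
    then have "conn \<theta> ?b b" using b B(1) by (intro conn_class_eqD[where A = A]) auto
    then have "conn \<theta> (f ?b) (f b)" using isomorphism_conn[OF f B(2)] b c by blast
    then show ?thesis unfolding \<sigma>_def by (rule conn_class_eq)
  qed
  \<comment> \<open>Isomorphism is demanded in both directions, which makes the relation symmetric
    by its form.\<close>
  let ?R = "\<lambda>K L. isomorphic K \<theta> L \<theta> \<and> isomorphic L \<theta> K \<theta>"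
  have st: "same_type \<theta> b (f b)" if "b \<in> B" for b
    by (rule isomorphism_same_type[OF f B(2) that])
  have st': "same_type \<theta> (f b) b" if "b \<in> B" for b
    using st[OF that] by (auto simp: same_type_def)
  have "inj_on \<sigma> (?k ` B)"
  proof (rule inj_onI, elim imageE)
    fix K L b c assume *: "\<sigma> K = \<sigma> L" "K = ?k b" "b \<in> B" "L = ?k c" "c \<in> B"
    then have "?k (f b) = ?k (f c)" using \<sigma> by simp
    then have "conn \<theta> (f b) (f c)" using * fC by (intro conn_class_eqD[where A = A]) auto
    then have "conn \<theta> b c" using isomorphism_conn[OF f B(2)] * by blast
    then show "K = L" using * conn_class_eq by metis
  qed
  moreover have "\<sigma> ` ?k ` B \<subseteq> ?k ` A" using \<sigma> fC by auto
  moreover have "?R K (\<sigma> K)" if K: "K \<in> ?k ` B" for K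
  proof -
    obtain b where b: "b \<in> B" "K = ?k b" using K by blast
    then show ?thesis
      using iso[OF _ _ st[OF b(1)]] iso[OF _ _ st'[OF b(1)]] fC B(1) \<sigma>[OF b(1)] by auto
  qed
  moreover have "symp ?R" "transp ?R"
    by (auto simp: symp_def transp_def intro: isomorphic_trans)
  moreover have "?k ` B \<subseteq> ?k ` A" using B(1) by blast
  \<comment> \<open>The identity is the bijection to be repaired; \<open>\<sigma>\<close> prescribes
    its values at finitely many components.\<close>
  ultimately have "\<exists>\<pi>. bij_betw \<pi> (?k ` A) (?k ` A) \<and> (\<forall>K\<in>?k ` A. ?R K (\<pi> K)) \<and>
      (\<forall>K\<in>?k ` B. \<pi> K = \<sigma> K)"
    using B(3) by (intro extend_finite_bij_betw[where h = id]) (auto intro: isomorphic_refl)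
  then obtain \<pi> where \<pi>: "bij_betw \<pi> (?k ` A) (?k ` A)" "\<And>K. K \<in> ?k ` A \<Longrightarrow> ?R K (\<pi> K)"
      "\<And>K. K \<in> ?k ` B \<Longrightarrow> \<pi> K = \<sigma> K"
    by metis
  \<comment> \<open>On a component that meets \<open>B\<close>, climb up from the piece of
    \<open>f\<close> inside it. Elsewhere nothing is prescribed, and any isomorphism onto
    \<open>\<pi> K\<close> will do.\<close>
  have "\<exists>e. isomorphism e K \<theta> (\<pi> K) \<theta> \<and> (\<forall>b\<in>B \<inter> K. e b = f b)" if K: "K \<in> ?k ` A" for K
  proof (cases "K \<in> ?k ` B")
    case True
    then obtain b where b: "b \<in> B" "K = ?k b" by blast
    have cl: "\<theta> x \<in> ?k z" if "x \<in> ?k z" for x z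
      using that closed conn_step conn_trans by (fastforce simp: conn_class_def)
    have "\<exists>g. isomorphism g (upward A \<theta> (B \<inter> ?k b)) \<theta> (upward A \<theta> (C \<inter> ?k (f b))) \<theta> \<and>
        (\<forall>x\<in>B \<inter> ?k b. g x = f x)"
    proof (rule extend_upward)
      show "isomorphism f (B \<inter> ?k b) \<theta> (C \<inter> ?k (f b)) \<theta>"
        by (rule isomorphism_conn_class[OF f B(2) b(1) B(1) C(1)])
      show "finite {a \<in> B \<inter> ?k b. \<theta> a = c}" for c
        by (rule finite_subset[OF _ B(4)[of c]]) auto
    qed (use B C closed pre cl in auto)
    then show ?thesis
      using upward_conn_class[OF B(1,2) b(1)] upward_conn_class[OF C fC(1)[OF b(1)]]
        \<pi>(3)[OF True] \<sigma>[OF b(1)] b(2) by simp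
  next
    case False
    have "B \<inter> K = {}"
    proof (rule ccontr)
      assume "B \<inter> K \<noteq> {}"
      then obtain b where "b \<in> B" "b \<in> K" by blast
      then have "K = ?k b" using K conn_class_eq[of \<theta> _ b A] by (auto simp: conn_class_def[of A \<theta>])
      then show False using False \<open>b \<in> B\<close> by blast
    qed
    then show ?thesis using \<pi>(2)[OF K] by (auto simp: isomorphic_def)
  qed
  then obtain e where e: "\<And>K. K \<in> ?k ` A \<Longrightarrow> isomorphism (e K) K \<theta> (\<pi> K) \<theta>"
      "\<And>K b. K \<in> ?k ` A \<Longrightarrow> b \<in> B \<inter> K \<Longrightarrow> e K b = f b"
    by metis
  have "automorphism (\<lambda>x. e (?k x) x) A \<theta>"
    by (rule glue_components[OF A \<pi>(1) e(1)])
  moreover have "e (?k b) b = f b" if "b \<in> B" for b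
    using that B(1) conn_class_self[of b A \<theta>] by (intro e(2)) auto
  ultimately show "\<exists>g. automorphism g A \<theta> \<and> (\<forall>x\<in>B. g x = f x)" by blast
qed

section \<open>The two directions of the equivalence\<close>

theorem theorem4p7:
  fixes A :: "'a set" and \<theta> :: "'a \<Rightarrow> 'a"
  assumes "monounary_algebra A \<theta>"
  shows "ultrahomogeneous A \<theta> \<longleftrightarrow>
    (\<forall>x\<in>A. \<forall>y\<in>A. isomorphic (monogenic \<theta> x) \<theta> (monogenic \<theta> y) \<theta> \<longrightarrow>
       preimage_in A \<theta> x \<approx> preimage_in A \<theta> y \<and>
       isomorphic (component_of A \<theta> x) \<theta> (component_of A \<theta> y) \<theta>)"
proof
  assume U: "ultrahomogeneous A \<theta>"
  have closed: "\<theta> x \<in> A" if "x \<in> A" for x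
    using that assms by (auto simp: monounary_algebra_def)
  show "\<forall>x\<in>A. \<forall>y\<in>A. isomorphic (monogenic \<theta> x) \<theta> (monogenic \<theta> y) \<theta> \<longrightarrow>
       preimage_in A \<theta> x \<approx> preimage_in A \<theta> y \<and>
       isomorphic (component_of A \<theta> x) \<theta> (component_of A \<theta> y) \<theta>"
  proof (intro ballI impI)
    fix x y
    assume x: "x \<in> A" and y: "y \<in> A"
      and "isomorphic (monogenic \<theta> x) \<theta> (monogenic \<theta> y) \<theta>"
    then have "same_type \<theta> x y" by (blast intro: isomorphic_monogenic_same_type)
    then obtain f where f: "isomorphism f (monogenic \<theta> x) \<theta> (monogenic \<theta> y) \<theta>" "f x = y"
      by (blast dest: same_type_isomorphism)
    \<comment> \<open>One generator suffices, so ultrahomogeneity applies to \<open>f\<close> and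
      gives an automorphism taking \<open>x\<close> to \<open>y\<close>.\<close>
    have "finitely_generated_subalgebra (monogenic \<theta> z) A \<theta>" if "z \<in> A" for z
      unfolding finitely_generated_subalgebra_def
      using generated_singleton[OF assms that] that by (intro exI[of _ "{z}"]) auto
    then obtain g where g: "automorphism g A \<theta>" "\<forall>z\<in>monogenic \<theta> x. g z = f z"
      using U f(1) x y unfolding ultrahomogeneous_def by blast
    then have gx: "g x = y" using f(2) monogenic_self by fastforce
    have "isomorphism g (A \<inter> conn_class A \<theta> x) \<theta> (A \<inter> conn_class A \<theta> (g x)) \<theta>"
      using g(1) closed x by (intro isomorphism_conn_class) (auto simp: automorphism_def)
    moreover have "A \<inter> conn_class A \<theta> z = conn_class A \<theta> z" for z
      by (auto simp: conn_class_def)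
    ultimately have "isomorphic (conn_class A \<theta> x) \<theta> (conn_class A \<theta> y) \<theta>"
      using gx by (auto simp: isomorphic_def)
    then show "preimage_in A \<theta> x \<approx> preimage_in A \<theta> y \<and>
       isomorphic (component_of A \<theta> x) \<theta> (component_of A \<theta> y) \<theta>"
      using automorphism_preimage_eqpoll[OF assms g(1) x] gx x y
      by (simp add: component_of_eq[OF assms])
  qed
next
  assume "\<forall>x\<in>A. \<forall>y\<in>A. isomorphic (monogenic \<theta> x) \<theta> (monogenic \<theta> y) \<theta> \<longrightarrow>
       preimage_in A \<theta> x \<approx> preimage_in A \<theta> y \<and>
       isomorphic (component_of A \<theta> x) \<theta> (component_of A \<theta> y) \<theta>"
  then show "ultrahomogeneous A \<theta>"
    by (intro ultrahomogeneous_if[OF assms])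
      (simp_all add: same_type_isomorphic component_of_eq[OF assms, symmetric])
qed

end
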